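(* Let $n$ be a non-negative integer. For every permutation $\sigma \in \mathfrak{S}_3$ and all forms $q_1,q_2,q_3\in\mathbb{Z}[x,y,z]_n$, the trilinear form $t_n$ satisfies \[ t_n (q_{\sigma(1)},q_{\sigma(2)},q_{\sigma(3)}) = (\operatorname{sign} \sigma)^n\, t_n (q_1,q_2,q_3), \] where $\operatorname{sign}\sigma$ denotes the sign of the permutation $\sigma$.
   Context: For a non-negative integer $n$, $\mathbb{Z}[x,y,z]_n$ and $\mathbb{Z}[u,v,w]_n$ denote the $\mathbb{Z}$-modules of homogeneous forms of degree $n$ in $x,y,z$ and in $u,v,w$ respectively. The polar pairing $\langle -,-\rangle \colon \mathbb{Z}[u,v,w]_n\times\mathbb{Z}[x,y,z]_n\to\mathbb{Z}$ is $\langle p,q\rangle = p(\partial_x,\partial_y,\partial_z)\,q(x,y,z)$; equivalently, it is the bilinear form with $\langle u^{a_1}v^{b_1}w^{c_1}, x^{a_2}y^{b_2}z^{c_2}\rangle = a_1!\,b_1!\,c_1!$ if $(a_1,b_1,c_1)=(a_2,b_2,c_2)$, and $0$ otherwise. The bilinear map $J_n\colon \mathbb{Z}[x,y,z]_n\times\mathbb{Z}[x,y,z]_n\to\mathbb{Z}[u,v,w]_n$ is \[ J_n(q_1,q_2)=q_1\bigl(w\,\partial_y - v\,\partial_z,\; u\,\partial_z - w\,\partial_x,\; v\,\partial_x-u\,\partial_y\bigr)\,q_2(x,y,z), \] where the differential operators act on $x,y,z$ only, treating $u,v,w$ as constants. The trilinear form $t_n\colon(\mathbb{Z}[x,y,z]_n)^{3}\to\mathbb{Z}$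 is $t_n(q_1,q_2,q_3)=\langle J_n(q_1,q_2),q_3\rangle$. *)

theory Defs
  imports Complex_Main "HOL-Library.Poly_Mapping" "HOL-Combinatorics.Permutations"
begin

text \<open>A polynomial over \<^typ>\<open>'a\<close> in the variables \<^typ>\<open>'v\<close> is a finitely supported map from
  exponent vectors to coefficients, with the ring structure of \<^theory>\<open>HOL-Library.Poly_Mapping\<close>.\<close>

type_synonym ('v, 'a) mpoly = "('v \<Rightarrow>\<^sub>0 nat) \<Rightarrow>\<^sub>0 'a"

datatype xyz = Vx | Vy | Vz
datatype uvw = Vu | Vv | Vw

definition mdeg :: "('v \<Rightarrow>\<^sub>0 nat) \<Rightarrow> nat"
  where "mdeg m = (\<Sum>v\<in>Poly_Mapping.keys m. Poly_Mapping.lookup m v)"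

text \<open>As usual, the zero polynomial belongs to \<open>forms n\<close> for every \<open>n\<close>.\<close>

definition forms :: "nat \<Rightarrow> ('v, 'a::zero) mpoly set"
  where "forms n = {p. \<forall>m\<in>Poly_Mapping.keys p. mdeg m = n}"

definition Var :: "'v \<Rightarrow> ('v, 'a::zero_neq_one) mpoly"
  where "Var v = Poly_Mapping.single (Poly_Mapping.single v 1) 1"

definition Const :: "'a::zero \<Rightarrow> ('v, 'a) mpoly"
  where "Const c = Poly_Mapping.single 0 c"

definition const_coeff :: "('v, 'a::zero) mpoly \<Rightarrow> 'a"
  where "const_coeff p = Poly_Mapping.lookup p 0"

text \<open>The subtraction of exponents is truncated, but where it truncates the coefficient is 0.\<close>

definition pd :: "'v \<Rightarrow> ('v, 'a::comm_ring_1) mpoly \<Rightarrow> ('v, 'a) mpoly"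
  where "pd v p = (\<Sum>m\<in>Poly_Mapping.keys p.
    Poly_Mapping.single (m - Poly_Mapping.single v 1)
      (of_nat (Poly_Mapping.lookup m v) * Poly_Mapping.lookup p m))"

text \<open>For \<open>As = [(v\<^sub>1, D\<^sub>1), \<dots>, (v\<^sub>k, D\<^sub>k)]\<close> with pairwise commuting additive operators \<open>D\<^sub>i\<close>,
  \<open>op_subst As q f\<close> is \<open>q(D\<^sub>1, \<dots>, D\<^sub>k) f\<close>.\<close>

definition op_subst ::
  "('v \<times> ('p \<Rightarrow> 'p)) list \<Rightarrow> ('v, int) mpoly \<Rightarrow> 'p \<Rightarrow> 'p::comm_ring_1"
  where "op_subst As q f = (\<Sum>m\<in>Poly_Mapping.keys q.
    of_int (Poly_Mapping.lookup q m) *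
      foldr (\<lambda>(v, D). D ^^ Poly_Mapping.lookup m v) As f)"

text \<open>The polynomial \<open>p(\<partial>\<^sub>x, \<partial>\<^sub>y, \<partial>\<^sub>z) q\<close>, and the integer it is when \<open>p\<close> and \<open>q\<close> are forms of the
  same degree (see \<open>polar_op_eq_Const\<close> below).\<close>

definition polar_op :: "(uvw, int) mpoly \<Rightarrow> (xyz, int) mpoly \<Rightarrow> (xyz, int) mpoly"
  where "polar_op = op_subst [(Vu, pd Vx), (Vv, pd Vy), (Vw, pd Vz)]"

definition polar :: "(uvw, int) mpoly \<Rightarrow> (xyz, int) mpoly \<Rightarrow> int"
  where "polar p q = const_coeff (polar_op p q)"

text \<open>The operators defining \<open>J\<^sub>n\<close> act on polynomials in \<open>x, y, z\<close> with coefficients in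
  \<open>\<int>[u, v, w]\<close>. Applied to two forms of the same degree in \<open>x, y, z\<close> the result is constant in
  \<open>x, y, z\<close> (see \<open>J_op_eq_Const\<close> below), hence an element of \<open>\<int>[u, v, w]\<close>.\<close>

definition J_op :: "(xyz, int) mpoly \<Rightarrow> (xyz, int) mpoly \<Rightarrow> (xyz, (uvw, int) mpoly) mpoly"
  where "J_op q1 q2 =
    (let u = Const (Var Vu); v = Const (Var Vv); w = Const (Var Vw) in
     op_subst
      [(Vx, \<lambda>f. w * pd Vy f - v * pd Vz f),
       (Vy, \<lambda>f. u * pd Vz f - w * pd Vx f),
       (Vz, \<lambda>f. v * pd Vx f - u * pd Vy f)]
      q1 (Poly_Mapping.map Const q2))"

definition J_form :: "(xyz, int) mpoly \<Rightarrow> (xyz, int) mpoly \<Rightarrow> (uvw, int) mpoly"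
  where "J_form q1 q2 = const_coeff (J_op q1 q2)"

text \<open>The formulas for \<open>J\<^sub>n\<close> and \<open>t\<^sub>n\<close> do not mention \<open>n\<close>: it only restricts the arguments
  to \<open>forms n\<close>.\<close>

definition t_form :: "(xyz, int) mpoly \<Rightarrow> (xyz, int) mpoly \<Rightarrow> (xyz, int) mpoly \<Rightarrow> int"
  where "t_form q1 q2 q3 = polar (J_form q1 q2) q3"

lemma mdeg_superset:
  assumes "finite A" "Poly_Mapping.keys m \<subseteq> A"
  shows "mdeg m = (\<Sum>v\<in>A. Poly_Mapping.lookup m v)"
  unfolding mdeg_def using assms
  by (intro sum.mono_neutral_left) (auto simp: in_keys_iff)

lemma mdeg_eq_0: "mdeg m = 0 \<longleftrightarrow> m = 0"
proof
  assume "mdeg m = 0"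
  then have "Poly_Mapping.lookup m v = 0" for v
    by (cases "v \<in> Poly_Mapping.keys m") (auto simp: mdeg_def in_keys_iff)
  then show "m = 0" by (intro poly_mapping_eqI) simp
qed (simp add: mdeg_def)

lemma mdeg_add: "mdeg (a + b) = mdeg a + mdeg b"
proof -
  let ?A = "Poly_Mapping.keys a \<union> Poly_Mapping.keys b"
  have "Poly_Mapping.keys (a + b) \<subseteq> ?A" by (rule keys_add)
  then show ?thesis
    using mdeg_superset[of ?A "a + b"] mdeg_superset[of ?A a] mdeg_superset[of ?A b]
    by (simp add: lookup_add sum.distrib)
qed

lemma mdeg_single [simp]: "mdeg (Poly_Mapping.single v k) = k"
  by (simp add: mdeg_def)

lemma mdeg_minus_single:
  assumes "Poly_Mapping.lookup m v \<noteq> 0"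
  shows "mdeg (m - Poly_Mapping.single v 1) = mdeg m - 1"
proof -
  have "m - Poly_Mapping.single v 1 + Poly_Mapping.single v 1 = m"
    using assms by (intro poly_mapping_eqI)
      (auto simp: lookup_add lookup_minus lookup_single when_def)
  then have "mdeg m = mdeg (m - Poly_Mapping.single v 1) + 1"
    by (metis mdeg_add mdeg_single)
  then show ?thesis by simp
qed

lemma forms_lookup: "p \<in> forms n \<longleftrightarrow> (\<forall>m. Poly_Mapping.lookup p m \<noteq> 0 \<longrightarrow> mdeg m = n)"
  by (auto simp: forms_def in_keys_iff)

lemma zero_in_forms [simp]: "0 \<in> forms n"
  by (simp add: forms_lookup)

lemma forms_add: "p \<in> forms n \<Longrightarrow> r \<in> forms n \<Longrightarrow> p + r \<in> forms n"
  for p r :: "('v, 'a::comm_ring_1) mpoly"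
  by (auto simp: forms_lookup lookup_add) (metis add_0)

lemma forms_uminus: "p \<in> forms n \<Longrightarrow> - p \<in> forms n"
  for p :: "('v, 'a::comm_ring_1) mpoly"
  by (auto simp: forms_lookup)

lemma forms_diff: "p \<in> forms n \<Longrightarrow> r \<in> forms n \<Longrightarrow> p - r \<in> forms n"
  for p r :: "('v, 'a::comm_ring_1) mpoly"
  using forms_add[of p n "- r"] forms_uminus[of r n] by simp

lemma forms_sum: "(\<And>i. i \<in> A \<Longrightarrow> f i \<in> forms n) \<Longrightarrow> sum f A \<in> forms n"
  for f :: "'i \<Rightarrow> ('v, 'a::comm_ring_1) mpoly"
  by (induction A rule: infinite_finite_induct) (auto intro: forms_add)

lemma forms_mult:
  fixes p r :: "('v, 'a::comm_ring_1) mpoly"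
  assumes "p \<in> forms k" "r \<in> forms l"
  shows "p * r \<in> forms (k + l)"
  using assms keys_mult[of p r] by (fastforce simp: forms_def mdeg_add)

lemma Const_in_forms: "Const c \<in> forms 0"
  by (auto simp: forms_lookup Const_def lookup_single when_def mdeg_def)

lemma Var_in_forms: "Var v \<in> forms 1"
  by (auto simp: forms_lookup Var_def lookup_single when_def)

lemma of_int_eq_Const: "of_int k = (Const (of_int k) :: ('v, 'a::comm_ring_1) mpoly)"
  by (simp add: Const_def)

lemma of_int_in_forms: "(of_int k :: ('v, 'a::comm_ring_1) mpoly) \<in> forms 0"
  unfolding of_int_eq_Const by (rule Const_in_forms)

lemma lookup_Const_mult: "Poly_Mapping.lookup (Const c * f) m = c * Poly_Mapping.lookup f m"
  for f :: "('v, 'a::comm_ring_1) mpoly"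
  unfolding Const_def mult_map_scale_conv_mult[symmetric] by (simp add: map.rep_eq when_def)

lemma pd_in_forms: "f \<in> forms n \<Longrightarrow> pd v f \<in> forms (n - 1)"
  for f :: "('v, 'a::comm_ring_1) mpoly"
  unfolding pd_def
proof (intro forms_sum)
  fix m assume "f \<in> forms n" "m \<in> Poly_Mapping.keys f"
  then show "Poly_Mapping.single (m - Poly_Mapping.single v 1)
      (of_nat (Poly_Mapping.lookup m v) * Poly_Mapping.lookup f m) \<in> forms (n - 1)"
    using mdeg_minus_single[of m v]
    by (cases "Poly_Mapping.lookup m v = 0")
       (auto simp: forms_lookup lookup_single when_def in_keys_iff)
qed

lemma forms_0_eq_Const: "g \<in> forms 0 \<Longrightarrow> g = Const (const_coeff g)"
  by (rule poly_mapping_eqI)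
     (auto simp: forms_lookup Const_def const_coeff_def lookup_single when_def mdeg_eq_0)

lemma op_subst_mem:
  fixes G :: "nat \<Rightarrow> 'p::comm_ring_1 set"
  assumes D: "\<And>v D k f. (v, D) \<in> set As \<Longrightarrow> f \<in> G k \<Longrightarrow> D f \<in> G (Suc k)"
    and G: "0 \<in> G n" "\<And>f g. f \<in> G n \<Longrightarrow> g \<in> G n \<Longrightarrow> f + g \<in> G n"
      "\<And>f c. f \<in> G n \<Longrightarrow> of_int c * f \<in> G n"
    and As: "distinct (map fst As)" "fst ` set As = UNIV"
    and q: "q \<in> forms n" and f: "f \<in> G 0"
  shows "op_subst As q f \<in> G n"
proof -
  have pow: "(D ^^ j) g \<in> G (j + k)" if "(v, D) \<in> set As" "g \<in> G k" for v D k g j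
    using that(2) by (induction j) (auto intro: D that(1))
  have step: "foldr (\<lambda>(v, D). D ^^ Poly_Mapping.lookup m v) Bs f
      \<in> G (\<Sum>v\<leftarrow>map fst Bs. Poly_Mapping.lookup m v)" if "set Bs \<subseteq> set As" for m Bs
    using that
  proof (induction Bs)
    case (Cons b Bs)
    then show ?case
      using pow[of "fst b" "snd b" _ _ "Poly_Mapping.lookup m (fst b)"]
      by (auto simp: case_prod_unfold)
  qed (simp add: f)
  have fin: "finite (UNIV :: 'a set)" using As(2) by (metis finite_imageI finite_set)
  have "mdeg m = (\<Sum>v\<leftarrow>map fst As. Poly_Mapping.lookup m v)" for m
    using As fin by (subst sum_list_distinct_conv_sum_set) (auto simp: mdeg_superset[of UNIV])
  with step[of As] q
  have mono: "foldr (\<lambda>(v, D). D ^^ Poly_Mapping.lookup m v) As f \<in> G n"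
    if "m \<in> Poly_Mapping.keys q" for m
    using that by (auto simp: forms_def)
  have sum: "sum h A \<in> G n" if "\<And>i. i \<in> A \<Longrightarrow> h i \<in> G n" for h :: "('a \<Rightarrow>\<^sub>0 nat) \<Rightarrow> 'p" and A
    using that by (induction A rule: infinite_finite_induct) (auto intro: G)
  show ?thesis unfolding op_subst_def by (intro sum G(3) mono)
qed

lemma UNIV_xyz: "UNIV = {Vx, Vy, Vz}" and UNIV_uvw: "UNIV = {Vu, Vv, Vw}"
  by (auto intro: xyz.exhaust uvw.exhaust)

lemma polar_op_eq_Const:
  assumes "p \<in> forms n" "q \<in> forms n"
  shows "polar_op p q = Const (polar p q)"
proof -
  have "polar_op p q \<in> forms (n - n)"
    unfolding polar_op_def
  proof (rule op_subst_mem[where G = "\<lambda>k. forms (n - k)"])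
    fix f :: "(xyz, int) mpoly" and c
    assume "f \<in> forms (n - n)"
    then show "of_int c * f \<in> forms (n - n)"
      using forms_mult[OF of_int_in_forms, of f] by simp
  next
    fix v k and D :: "(xyz, int) mpoly \<Rightarrow> (xyz, int) mpoly" and f :: "(xyz, int) mpoly"
    assume "(v, D) \<in> set [(Vu, pd Vx), (Vv, pd Vy), (Vw, pd Vz)]" "f \<in> forms (n - k)"
    then show "D f \<in> forms (n - Suc k)"
      using pd_in_forms[of f "n - k"] by auto
  qed (use assms in \<open>auto intro: forms_add simp: UNIV_uvw\<close>)
  then show ?thesis using forms_0_eq_Const[of "polar_op p q"] by (simp add: polar_def)
qed

lemma
  assumes q1: "q1 \<in> forms n" and q2: "q2 \<in> forms n"
  shows J_op_eq_Const: "J_op q1 q2 = Const (J_form q1 q2)"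
    and J_form_in_forms: "J_form q1 q2 \<in> forms n"
proof -
  define G :: "nat \<Rightarrow> (xyz, (uvw, int) mpoly) mpoly set"
    where "G k = {f \<in> forms (n - k). \<forall>m. Poly_Mapping.lookup f m \<in> forms k}" for k
  have lookup_pd: "Poly_Mapping.lookup (pd v f) m \<in> forms k"
    if "f \<in> G k" for v f m k
    unfolding pd_def lookup_sum
  proof (intro forms_sum)
    fix m' assume "m' \<in> Poly_Mapping.keys f"
    have "of_nat j * Poly_Mapping.lookup f m' \<in> forms k" for j
      using that forms_mult[OF of_int_in_forms[of "int j"], of "Poly_Mapping.lookup f m'" k]
      by (simp add: G_def)
    then show "Poly_Mapping.lookup (Poly_Mapping.single (m' - Poly_Mapping.single v 1)
        (of_nat (Poly_Mapping.lookup m' v) * Poly_Mapping.lookup f m')) m \<in> forms k"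
      by (simp add: lookup_single when_def)
  qed
  have 1: "Const (Var a) * pd v f \<in> G (Suc k)" if "f \<in> G k" for a v f k
    using that forms_mult[OF Const_in_forms pd_in_forms, of f "n - k"]
      forms_mult[OF Var_in_forms lookup_pd, of f k]
    by (simp add: G_def lookup_Const_mult)
  have 2: "f - g \<in> G k" if "f \<in> G k" "g \<in> G k" for f g k
    using that by (auto simp: G_def lookup_minus intro: forms_diff)
  have "J_op q1 q2 \<in> G n"
    unfolding J_op_def Let_def
  proof (rule op_subst_mem[where G = G])
    fix f :: "(xyz, (uvw, int) mpoly) mpoly" and c
    assume f: "f \<in> G n"
    have "Poly_Mapping.lookup (of_int c * f) m \<in> forms n" for m
      using f forms_mult[OF of_int_in_forms[of c], of "Poly_Mapping.lookup f m" n]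
      by (simp add: of_int_eq_Const[where 'a = "(uvw, int) mpoly"] lookup_Const_mult G_def)
    moreover have "of_int c * f \<in> forms (n - n)"
      using f forms_mult[OF of_int_in_forms[of c], of f "n - n"] by (simp add: G_def)
    ultimately show "of_int c * f \<in> G n" by (simp add: G_def)
  next
    show "Poly_Mapping.map Const q2 \<in> G 0"
      using q2 by (auto simp: G_def forms_lookup[of "Poly_Mapping.map Const q2"]
        forms_lookup[of q2] map.rep_eq when_def Const_in_forms)
  qed (auto simp: UNIV_xyz q1 intro: 1 2, auto simp: G_def lookup_add intro: forms_add)
  then have "J_op q1 q2 \<in> forms 0" "J_form q1 q2 \<in> forms n"
    by (auto simp: G_def J_form_def const_coeff_def)
  then show "J_op q1 q2 = Const (J_form q1 q2)" "J_form q1 q2 \<in> forms n"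
    using forms_0_eq_Const[of "J_op q1 q2"] by (simp_all add: J_form_def)
qed

end

theory Submission
  imports Defs
begin

text \<open>
  The form \<open>t\<^sub>n\<close> is symmetric up to sign because it is a hidden determinant: writing \<open>X\<close>, \<open>Y\<close>, \<open>Z\<close>
  for the three columns of a \<open>3 \<times> 3\<close> matrix of variables, \<open>t\<^sub>n(q\<^sub>1, q\<^sub>2, q\<^sub>3)\<close> is, up to the factor
  \<open>n!\<close>, the result of applying \<open>q\<^sub>1(\<partial>\<^sub>X) q\<^sub>2(\<partial>\<^sub>Y) q\<^sub>3(\<partial>\<^sub>Z)\<close> to \<open>det(X, Y, Z)\<^sup>n\<close>, and permuting the
  columns changes the \<open>n\<close>-th power of the determinant by the \<open>n\<close>-th power of the sign.

  The proof splits off one variable, that is, one factor of the determinant, at a time, so that no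
  expansion with factorials occurs. Let \<open>\<epsilon>\<^sub>i\<^sub>j\<^sub>k\<close> be the Levi-Civita symbol and write \<open>x\<^sub>1, x\<^sub>2, x\<^sub>3\<close> for \<open>x, y, z\<close>. Substituting
  commuting operators into a polynomial turns products into compositions, so for all polynomials,
  homogeneous or not,
  \<open>t(x\<^sub>i p, q, r) = \<Sum>\<^sub>j\<^sub>k \<epsilon>\<^sub>i\<^sub>j\<^sub>k t(p, \<partial>\<^sub>j q, \<partial>\<^sub>k r)\<close> (\<open>t_form_Var_mult_1\<close>).
  Together with its value at constants (\<open>t_form_Const\<close>) and additivity this recursion determines
  \<open>t\<close>. The right-hand side changes sign when \<open>q\<close> and \<open>r\<close> are exchanged, and a form \<open>p\<close> of degree
  \<open>n\<close> is reached after \<open>n\<close> such steps, hence the factor \<open>(-1)\<^sup>n\<close> for the transposition of the last two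
  arguments (\<open>t_form_swap_23\<close>). The definition of \<open>t\<close> treats its first two arguments very
  differently, but by induction on \<open>p\<close> the recursion implies the analogous one in the second argument,
  \<open>t(p, x\<^sub>j q, r) = \<Sum>\<^sub>i\<^sub>k \<epsilon>\<^sub>i\<^sub>j\<^sub>k t(\<partial>\<^sub>i p, q, \<partial>\<^sub>k r)\<close> (\<open>t_form_Var_mult_2\<close>),
  and comparing the two gives the transposition of the first two arguments (\<open>t_form_swap_12\<close>).
  These two transpositions generate the symmetric group.
\<close>

section \<open>Polynomials and their monomials\<close>

lemma sum_monomials: "(\<Sum>m\<in>Poly_Mapping.keys p. Poly_Mapping.single m (Poly_Mapping.lookup p m)) = p"
  by (rule poly_mapping_eqI)
     (auto simp: lookup_sum lookup_single when_def sum.delta in_keys_iff)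

lemma lookup_Var_mult:
  fixes p :: "('v, 'a::comm_ring_1) mpoly"
  shows "Poly_Mapping.lookup (Var v * p) m =
    (if Poly_Mapping.lookup m v = 0 then 0
     else Poly_Mapping.lookup p (m - Poly_Mapping.single v 1))"
proof -
  let ?X = "Poly_Mapping.single v (1::nat)"
  have eq: "?X + k = m \<longleftrightarrow> Poly_Mapping.lookup m v \<noteq> 0 \<and> k = m - ?X" for k
    by (auto simp: poly_mapping_eq_iff fun_eq_iff lookup_add lookup_minus lookup_single when_def)
  have "Var v * p = (\<Sum>k\<in>Poly_Mapping.keys p. Poly_Mapping.single (?X + k) (Poly_Mapping.lookup p k))"
    by (subst sum_monomials[of p, symmetric])
       (simp add: Var_def sum_distrib_left mult_single)
  then have "Poly_Mapping.lookup (Var v * p) m =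
      (\<Sum>k\<in>Poly_Mapping.keys p. if ?X + k = m then Poly_Mapping.lookup p k else 0)"
    by (simp add: lookup_sum lookup_single when_def)
  then show ?thesis
    by (auto simp: eq sum.delta in_keys_iff simp del: One_nat_def)
qed

lemma lookup_Var_mult_shift:
  fixes p :: "('v, 'a::comm_ring_1) mpoly"
  shows "Poly_Mapping.lookup (Var v * p) (Poly_Mapping.single v 1 + m) = Poly_Mapping.lookup p m"
  by (simp add: lookup_Var_mult lookup_add)

lemma keys_Var_mult:
  fixes p :: "('v, 'a::comm_ring_1) mpoly"
  shows "Poly_Mapping.keys (Var v * p) = (+) (Poly_Mapping.single v 1) ` Poly_Mapping.keys p"
proof -
  have "m \<in> (+) (Poly_Mapping.single v 1) ` Poly_Mapping.keys p"
    if "Poly_Mapping.lookup m v \<noteq> 0" "m - Poly_Mapping.single v 1 \<in> Poly_Mapping.keys p" for m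
  proof (rule image_eqI)
    show "m = Poly_Mapping.single v 1 + (m - Poly_Mapping.single v 1)"
      using that(1)
      by (auto intro!: poly_mapping_eqI simp: lookup_add lookup_minus lookup_single when_def)
  qed fact
  then show ?thesis
    by (auto simp: in_keys_iff lookup_Var_mult lookup_add simp del: One_nat_def split: if_splits)
qed

text \<open>The degree is an argument of \<open>P\<close> so that it can count the variables split off, which is where
  the exponent of the sign comes from. The zero polynomial lies in every degree, and it is reached in
  degree \<open>n\<close> as a product of \<open>n\<close> variables and the constant 0.\<close>

lemma form_induct [consumes 1, case_names const add Var_mult]:
  fixes p :: "('v, 'a::comm_ring_1) mpoly"
  assumes "p \<in> forms n"
    and const: "\<And>c. P 0 (Const c)"
    and add: "\<And>n p q. P n p \<Longrightarrow> P n q \<Longrightarrow> P n (p + q)"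
    and Var_mult: "\<And>n v p. P n p \<Longrightarrow> P (Suc n) (Var v * p)"
  shows "P n p"
proof -
  have monom: "P (mdeg m) (Poly_Mapping.single m c)" for m c
  proof (induction k \<equiv> "mdeg m" arbitrary: m)
    case 0
    then have "m = 0" by (simp add: mdeg_eq_0)
    then show ?case using const[of c] by (simp add: Const_def mdeg_def)
  next
    case (Suc k)
    then obtain v where v: "Poly_Mapping.lookup m v \<noteq> 0"
      by (metis lookup_zero mdeg_eq_0 nat.distinct(1) poly_mapping_eqI)
    let ?m = "m - Poly_Mapping.single v 1"
    have "Poly_Mapping.single v 1 + ?m = m"
      using v by (auto intro!: poly_mapping_eqI simp: lookup_add lookup_minus lookup_single when_def)
    then have "Poly_Mapping.single m c = Var v * Poly_Mapping.single ?m c"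
      by (simp add: Var_def mult_single)
    then show ?case
      using Suc(1)[of ?m] Suc(2)[symmetric] mdeg_minus_single[OF v]
        Var_mult[of k "Poly_Mapping.single ?m c" v] by simp
  qed
  have zero: "P n 0"
    by (induction n) (use const[of 0] Var_mult[of _ 0] in \<open>auto simp: Const_def\<close>)
  have "P n (\<Sum>m\<in>K. Poly_Mapping.single m (Poly_Mapping.lookup p m))"
    if "K \<subseteq> Poly_Mapping.keys p" for K
    using finite_subset[OF that finite_keys] that
  proof (induction K rule: finite_induct)
    case (insert m K)
    then have "mdeg m = n" using \<open>p \<in> forms n\<close> by (auto simp: forms_def)
    then show ?case using insert add monom[of m] by auto
  qed (simp add: zero)
  from this[of "Poly_Mapping.keys p"] show ?thesis by (simp add: sum_monomials)
qed

text \<open>The version for identities whose shape does not depend on the degree, such as the recursion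
  in the second argument, which must be applied to derivatives of the polynomial at hand.\<close>

lemma mpoly_induct [case_names const add Var_mult]:
  fixes p :: "('v, 'a::comm_ring_1) mpoly"
  assumes const: "\<And>c. P (Const c)"
    and add: "\<And>p q. P p \<Longrightarrow> P q \<Longrightarrow> P (p + q)"
    and Var_mult: "\<And>v p. P p \<Longrightarrow> P (Var v * p)"
  shows "P p"
proof -
  have monom: "P (Poly_Mapping.single m c)" for m c
  proof -
    have "Poly_Mapping.single m c \<in> forms (mdeg m)"
      by (simp add: forms_lookup lookup_single when_def)
    then show ?thesis
      by (induction rule: form_induct) (auto intro: assms)
  qed
  have zero: "P 0" using const[of 0] by (simp add: Const_def)
  have "P (\<Sum>m\<in>K. Poly_Mapping.single m (Poly_Mapping.lookup p m))" for K
    by (induction K rule: infinite_finite_induct) (auto intro: zero add monom)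
  from this[of "Poly_Mapping.keys p"] show ?thesis by (simp add: sum_monomials)
qed

section \<open>Partial derivatives\<close>

text \<open>The coefficientwise description makes every rule of differentiation below a comparison of
  coefficients.\<close>

lemma lookup_pd:
  fixes p :: "('v, 'a::comm_ring_1) mpoly"
  shows "Poly_Mapping.lookup (pd v p) m =
    of_nat (Suc (Poly_Mapping.lookup m v)) * Poly_Mapping.lookup p (m + Poly_Mapping.single v 1)"
proof -
  let ?X = "Poly_Mapping.single v (1::nat)"
  have "Poly_Mapping.lookup (Poly_Mapping.single (k - ?X)
      (of_nat (Poly_Mapping.lookup k v) * Poly_Mapping.lookup p k)) m =
    (if k = m + ?X then of_nat (Poly_Mapping.lookup k v) * Poly_Mapping.lookup p k else 0)" for k
  proof (cases "Poly_Mapping.lookup k v = 0")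
    case True
    then have "k \<noteq> m + ?X" by (auto simp: lookup_add)
    then show ?thesis using True by (simp add: lookup_single)
  next
    case False
    then have "k - ?X = m \<longleftrightarrow> k = m + ?X"
      by (auto simp: poly_mapping_eq_iff fun_eq_iff lookup_add lookup_minus lookup_single when_def)
    then show ?thesis by (simp add: lookup_single when_def)
  qed
  then show ?thesis
    unfolding pd_def lookup_sum by (auto simp: sum.delta' sum.delta in_keys_iff lookup_add)
qed

lemma pd_add: "pd v (p + q) = pd v p + pd v q"
  by (rule poly_mapping_eqI) (simp add: lookup_pd lookup_add algebra_simps)

lemma pd_diff: "pd v (p - q) = pd v p - pd v q"
  by (rule poly_mapping_eqI) (simp add: lookup_pd lookup_minus algebra_simps)

lemma pd_commute: "pd v (pd w p) = pd w (pd v p)"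
  by (cases "v = w"; intro poly_mapping_eqI)
     (simp_all add: lookup_pd lookup_add lookup_single_not_eq ac_simps)

lemma pd_Const_mult: "pd v (Const a * p) = Const a * pd v p"
  by (rule poly_mapping_eqI) (simp add: lookup_pd lookup_Const_mult mult.left_commute)

lemma pd_Const: "pd v (Const c) = 0"
proof (rule poly_mapping_eqI)
  fix m
  have "mdeg (m + Poly_Mapping.single v 1) \<noteq> 0"
    by (simp add: mdeg_add)
  then have "m + Poly_Mapping.single v 1 \<noteq> 0"
    unfolding mdeg_eq_0 .
  then show "Poly_Mapping.lookup (pd v (Const c)) m = Poly_Mapping.lookup 0 m"
    by (simp add: lookup_pd Const_def lookup_single_not_eq)
qed

lemma pd_Var_mult:
  fixes p :: "('v, 'a::comm_ring_1) mpoly"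
  shows "pd v (Var w * p) = (if v = w then p else 0) + Var w * pd v p"
proof (rule poly_mapping_eqI)
  fix m :: "'v \<Rightarrow>\<^sub>0 nat"
  let ?X = "Poly_Mapping.single v (1::nat)" and ?Y = "Poly_Mapping.single w (1::nat)"
  have "m + ?X - ?Y = m - ?Y + ?X" if "Poly_Mapping.lookup m w \<noteq> 0"
    using that
    by (auto intro!: poly_mapping_eqI simp: lookup_add lookup_minus lookup_single when_def)
  then show "Poly_Mapping.lookup (pd v (Var w * p)) m =
      Poly_Mapping.lookup ((if v = w then p else 0) + Var w * pd v p) m"
    by (cases "v = w")
       (auto simp: lookup_pd lookup_Var_mult lookup_add lookup_minus lookup_single_not_eq
         distrib_right simp del: One_nat_def)
qed

lemma lookup_map_Const: "Poly_Mapping.lookup (Poly_Mapping.map Const p) m = Const (Poly_Mapping.lookup p m)"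
  by (simp add: map.rep_eq when_def Const_def)

lemma map_Const_add: "Poly_Mapping.map Const (p + q) = Poly_Mapping.map Const p + Poly_Mapping.map Const q"
  for p q :: "('v, 'a::comm_ring_1) mpoly"
  by (rule poly_mapping_eqI) (simp add: lookup_map_Const lookup_add Const_def single_add)

lemma pd_map_Const: "pd v (Poly_Mapping.map Const p) = Poly_Mapping.map Const (pd v p)"
  for p :: "('v, 'a::comm_ring_1) mpoly"
proof (rule poly_mapping_eqI)
  have "of_nat k * Const c = Const (of_nat k * c)" for k and c :: 'a
    by (induction k) (simp_all add: Const_def distrib_right single_add)
  then show "Poly_Mapping.lookup (pd v (Poly_Mapping.map Const p)) m =
      Poly_Mapping.lookup (Poly_Mapping.map Const (pd v p)) m" for m
    by (simp add: lookup_pd lookup_map_Const del: of_nat_Suc)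
qed

section \<open>Substituting commuting operators into a polynomial\<close>

lemma foldr_ops_commute:
  assumes "\<And>v D x. (v, D) \<in> set As \<Longrightarrow> h (D x) = D (h x)"
  shows "h (foldr (\<lambda>(v, D). D ^^ k v) As x) = foldr (\<lambda>(v, D). D ^^ k v) As (h x)"
  using assms
proof (induction As)
  case (Cons b Bs)
  have "h ((snd b ^^ j) y) = (snd b ^^ j) (h y)" for j y
    by (induction j) (auto simp: Cons.prems[of "fst b" "snd b"])
  moreover have "h (foldr (\<lambda>(v, D). D ^^ k v) Bs x) = foldr (\<lambda>(v, D). D ^^ k v) Bs (h x)"
    by (rule Cons.IH) (meson Cons.prems list.set_intros(2))
  ultimately show ?case by (simp add: case_prod_unfold)
qed simp

lemma foldr_ops_add:
  fixes x y :: "'p::comm_ring_1"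
  assumes "\<And>v D. (v, D) \<in> set As \<Longrightarrow> additive D"
  shows "foldr (\<lambda>(v, D). D ^^ k v) As (x + y) =
    foldr (\<lambda>(v, D). D ^^ k v) As x + foldr (\<lambda>(v, D). D ^^ k v) As y"
  using assms
proof (induction As)
  case (Cons b Bs)
  have "(snd b ^^ j) (x + y) = (snd b ^^ j) x + (snd b ^^ j) y" for j x y
    by (induction j) (auto simp: additive.add[OF Cons.prems[of "fst b" "snd b"]])
  moreover have "foldr (\<lambda>(v, D). D ^^ k v) Bs (x + y) =
      foldr (\<lambda>(v, D). D ^^ k v) Bs x + foldr (\<lambda>(v, D). D ^^ k v) Bs y"
    by (rule Cons.IH) (meson Cons.prems list.set_intros(2))
  ultimately show ?case by (simp add: case_prod_unfold)
qed simp

text \<open>Raising the exponent of \<open>v\<close> by one inserts one more \<open>D\<close> at the place of \<open>v\<close> in the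
  composition; since \<open>D\<close> commutes with the operators after it, it can be moved to the argument.\<close>

lemma foldr_ops_shift:
  assumes "distinct (map fst As)" "(v, D) \<in> set As"
    and "\<And>w E x. (w, E) \<in> set As \<Longrightarrow> D (E x) = E (D x)"
  shows "foldr (\<lambda>(w, E). E ^^ Poly_Mapping.lookup (Poly_Mapping.single v 1 + m) w) As x =
    foldr (\<lambda>(w, E). E ^^ Poly_Mapping.lookup m w) As (D x)"
  using assms
proof (induction As)
  case (Cons b Bs)
  show ?case
  proof (cases "fst b = v")
    case True
    then have notin: "v \<notin> fst ` set Bs" using Cons.prems(1) by auto
    then have b: "b = (v, D)" using Cons.prems(2) True by (force simp: image_iff)
    have "foldr (\<lambda>(w, E). E ^^ Poly_Mapping.lookup (Poly_Mapping.single v 1 + m) w) Bs x =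
        foldr (\<lambda>(w, E). E ^^ Poly_Mapping.lookup m w) Bs x"
      using notin
      by (intro foldr_cong) (force simp: lookup_add lookup_single_not_eq image_iff)+
    moreover have "D (foldr (\<lambda>(w, E). E ^^ Poly_Mapping.lookup m w) Bs x) =
        foldr (\<lambda>(w, E). E ^^ Poly_Mapping.lookup m w) Bs (D x)"
      by (rule foldr_ops_commute) (meson Cons.prems(3) list.set_intros(2))
    ultimately show ?thesis
      by (simp add: b lookup_add funpow_swap1)
  next
    case False
    have "foldr (\<lambda>(w, E). E ^^ Poly_Mapping.lookup (Poly_Mapping.single v 1 + m) w) Bs x =
        foldr (\<lambda>(w, E). E ^^ Poly_Mapping.lookup m w) Bs (D x)"
      using Cons.prems(1,2) False
      by (intro Cons.IH) (auto intro: Cons.prems(3))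
    then show ?thesis
      using False by (simp add: case_prod_unfold lookup_add lookup_single_not_eq)
  qed
qed simp

lemma op_subst_superset:
  assumes "finite K" "Poly_Mapping.keys q \<subseteq> K"
  shows "op_subst As q f = (\<Sum>m\<in>K. of_int (Poly_Mapping.lookup q m) *
    foldr (\<lambda>(v, D). D ^^ Poly_Mapping.lookup m v) As f)"
  unfolding op_subst_def using assms
  by (intro sum.mono_neutral_left) (auto simp: in_keys_iff)

lemma op_subst_add_left: "op_subst As (p + q) f = op_subst As p f + op_subst As q f"
proof -
  let ?K = "Poly_Mapping.keys p \<union> Poly_Mapping.keys q"
  have "Poly_Mapping.keys (p + q) \<subseteq> ?K" by (rule keys_add)
  then show ?thesis
    using op_subst_superset[of ?K "p + q" As f] op_subst_superset[of ?K p As f]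
      op_subst_superset[of ?K q As f]
    by (simp add: lookup_add sum.distrib distrib_right)
qed

lemma additive_op_subst:
  assumes "\<And>v D. (v, D) \<in> set As \<Longrightarrow> additive D"
  shows "additive (op_subst As q)"
  by standard (simp add: op_subst_def foldr_ops_add[OF assms] distrib_left sum.distrib)

lemma additive_of_int_mult:
  fixes h :: "'p::comm_ring_1 \<Rightarrow> 'p"
  assumes "additive h"
  shows "h (of_int c * x) = of_int c * h x"
proof -
  interpret additive h by fact
  have "h (of_nat k * y) = of_nat k * h y" for k y
    by (induction k) (simp_all add: zero add distrib_right)
  then show ?thesis by (cases c) (simp_all add: minus del: of_nat_Suc)
qed

lemma op_subst_commute:
  assumes "additive h" "\<And>v D x. (v, D) \<in> set As \<Longrightarrow> h (D x) = D (h x)"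
  shows "h (op_subst As q f) = op_subst As q (h f)"
  by (simp add: op_subst_def additive.sum[OF assms(1)] additive_of_int_mult[OF assms(1)]
      foldr_ops_commute[OF assms(2)])

lemma op_subst_Const: "op_subst As (Const c) f = of_int c * f"
proof -
  have "foldr (\<lambda>(v, D). D ^^ 0) As f = f" by (induction As) auto
  then show ?thesis
    using op_subst_superset[of "{0}" "Const c" As f] by (simp add: Const_def)
qed

text \<open>The homomorphism property \<open>(x\<^sub>v q)(D) = q(D) \<circ> D\<^sub>v\<close>. Applying \<open>D\<^sub>v\<close> first, rather than
  last, yields recursions in which all derivatives fall on the other arguments.\<close>

lemma op_subst_Var_mult:
  assumes "distinct (map fst As)" "(v, D) \<in> set As"
    and "\<And>w E x. (w, E) \<in> set As \<Longrightarrow> D (E x) = E (D x)"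
  shows "op_subst As (Var v * q) f = op_subst As q (D f)"
  unfolding op_subst_def keys_Var_mult
  by (subst sum.reindex) (simp_all add: lookup_Var_mult_shift foldr_ops_shift[OF assms] del: One_nat_def)

section \<open>The trilinear form\<close>

lemma const_coeff_add: "const_coeff (p + q) = const_coeff p + const_coeff q"
  by (simp add: const_coeff_def lookup_add)

lemma const_coeff_diff: "const_coeff (p - q) = const_coeff p - const_coeff q"
  by (simp add: const_coeff_def lookup_minus)

lemma const_coeff_Const: "const_coeff (Const c) = c"
  by (simp add: const_coeff_def Const_def)

lemma const_coeff_Const_mult: "const_coeff (Const a * p) = a * const_coeff p"
  for p :: "('v, 'a::comm_ring_1) mpoly"
  by (simp add: const_coeff_def lookup_Const_mult)

lemma const_coeff_Var_mult: "const_coeff (Var v * p) = 0"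
  for p :: "('v, 'a::comm_ring_1) mpoly"
  by (simp add: const_coeff_def lookup_Var_mult)

lemma polar_add_left: "polar (p + p') r = polar p r + polar p' r"
  by (simp add: polar_def polar_op_def op_subst_add_left const_coeff_add)

lemma polar_add_right: "polar p (r + r') = polar p r + polar p r'"
proof -
  have "additive (polar_op p)"
    unfolding polar_op_def by (rule additive_op_subst) (auto simp: additive_def pd_add)
  then show ?thesis by (simp add: polar_def additive.add const_coeff_add)
qed

lemma polar_Const: "polar (Const c) r = c * const_coeff r"
  using const_coeff_Const_mult[of c r]
  by (simp add: polar_def polar_op_def op_subst_Const of_int_eq_Const)

text \<open>Multiplication by a variable is adjoint to the corresponding derivative.\<close>

lemma polar_Var_mult:
  "polar (Var Vu * p) r = polar p (pd Vx r)"
  "polar (Var Vv * p) r = polar p (pd Vy r)"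
  "polar (Var Vw * p) r = polar p (pd Vz r)"
  unfolding polar_def polar_op_def
  by (rule arg_cong[where f = const_coeff], rule op_subst_Var_mult; auto simp: pd_commute)+

lemma polar_diff_left: "polar (p - p') r = polar p r - polar p' r"
  using polar_add_left[of "p - p'" p' r] by simp

text \<open>The coordinates of the cross product of \<open>(\<partial>\<^sub>x, \<partial>\<^sub>y, \<partial>\<^sub>z)\<close> and \<open>(u, v, w)\<close>, which is where the
  Levi-Civita symbol comes from.\<close>

definition J_ops :: "(xyz \<times> ((xyz, (uvw, int) mpoly) mpoly \<Rightarrow> (xyz, (uvw, int) mpoly) mpoly)) list"
  where "J_ops =
    [(Vx, \<lambda>f. Const (Var Vw) * pd Vy f - Const (Var Vv) * pd Vz f),
     (Vy, \<lambda>f. Const (Var Vu) * pd Vz f - Const (Var Vw) * pd Vx f),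
     (Vz, \<lambda>f. Const (Var Vv) * pd Vx f - Const (Var Vu) * pd Vy f)]"

lemma J_form_eq: "J_form p q = const_coeff (op_subst J_ops p (Poly_Mapping.map Const q))"
  by (simp add: J_form_def J_op_def J_ops_def Let_def)

lemma additive_J_ops: "(v, D) \<in> set J_ops \<Longrightarrow> additive D"
  by (auto simp: J_ops_def additive_def pd_add algebra_simps)

lemma J_ops_commute: "(v, D) \<in> set J_ops \<Longrightarrow> (w, E) \<in> set J_ops \<Longrightarrow> D (E x) = E (D x)"
  by (auto simp: J_ops_def pd_diff pd_Const_mult pd_commute algebra_simps)

lemma op_subst_J_ops_Const_mult:
  "op_subst J_ops p (Const a * f) = Const a * op_subst J_ops p f"
  by (rule op_subst_commute[symmetric])
     (auto simp: additive_def J_ops_def pd_Const_mult distrib_left right_diff_distrib mult.left_commute)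

lemma J_form_add_left: "J_form (p + p') q = J_form p q + J_form p' q"
  by (simp add: J_form_eq op_subst_add_left const_coeff_add)

lemma J_form_add_right: "J_form p (q + q') = J_form p q + J_form p q'"
  by (simp add: J_form_eq map_Const_add additive.add[OF additive_op_subst[OF additive_J_ops]]
      const_coeff_add)

lemma J_form_Const: "J_form (Const c) q = Const (c * const_coeff q)"
proof -
  have "J_form (Const c) q = of_int c * Const (const_coeff q)"
    using const_coeff_Const_mult[of "of_int c" "Poly_Mapping.map Const q"]
    by (simp add: J_form_eq op_subst_Const of_int_eq_Const[where 'a = "(uvw, int) mpoly"])
       (simp add: const_coeff_def lookup_map_Const)
  then show ?thesis by (simp add: of_int_eq_Const Const_def mult_single)
qed

lemma J_form_Var_mult:
  "J_form (Var Vx * p) q = Var Vw * J_form p (pd Vy q) - Var Vv * J_form p (pd Vz q)"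
  "J_form (Var Vy * p) q = Var Vu * J_form p (pd Vz q) - Var Vw * J_form p (pd Vx q)"
  "J_form (Var Vz * p) q = Var Vv * J_form p (pd Vx q) - Var Vu * J_form p (pd Vy q)"
proof -
  have step: "J_form (Var v * p) q = a * J_form p (pd v1 q) - b * J_form p (pd v2 q)"
    if v: "(v, \<lambda>f. Const a * pd v1 f - Const b * pd v2 f) \<in> set J_ops" for v v1 v2 a b
  proof -
    have "J_form (Var v * p) q =
        const_coeff (op_subst J_ops p (Const a * pd v1 (Poly_Mapping.map Const q)
          - Const b * pd v2 (Poly_Mapping.map Const q)))"
      unfolding J_form_eq
      by (subst op_subst_Var_mult[OF _ v]) (auto simp: J_ops_def intro: J_ops_commute[OF v])
    then show ?thesis
      by (simp add: pd_map_Const additive.diff[OF additive_op_subst[OF additive_J_ops]]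
          op_subst_J_ops_Const_mult const_coeff_diff const_coeff_Const_mult J_form_eq)
  qed
  show "J_form (Var Vx * p) q = Var Vw * J_form p (pd Vy q) - Var Vv * J_form p (pd Vz q)"
    and "J_form (Var Vy * p) q = Var Vu * J_form p (pd Vz q) - Var Vw * J_form p (pd Vx q)"
    and "J_form (Var Vz * p) q = Var Vv * J_form p (pd Vx q) - Var Vu * J_form p (pd Vy q)"
    by (rule step; simp add: J_ops_def)+
qed

lemma t_form_add:
  "t_form (p + p') q r = t_form p q r + t_form p' q r"
  "t_form p (q + q') r = t_form p q r + t_form p q' r"
  "t_form p q (r + r') = t_form p q r + t_form p q r'"
  by (simp_all add: t_form_def J_form_add_left J_form_add_right polar_add_left polar_add_right)

lemma t_form_zero: "t_form 0 q r = 0" "t_form p 0 r = 0"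
  using t_form_add(1)[of 0 0 q r] t_form_add(2)[of p 0 0 r] by simp_all

lemma t_form_Const: "t_form (Const c) q r = c * const_coeff q * const_coeff r"
  by (simp add: t_form_def J_form_Const polar_Const)

text \<open>The cyclic order of the variables encodes the Levi-Civita symbol: for fixed \<open>a\<close> its nonzero
  values are \<open>1\<close> at \<open>(a, nxt a, nxt (nxt a))\<close> and \<open>-1\<close> at \<open>(a, nxt (nxt a), nxt a)\<close>.\<close>

fun nxt :: "xyz \<Rightarrow> xyz"
  where "nxt Vx = Vy" | "nxt Vy = Vz" | "nxt Vz = Vx"

text \<open>The operator substituted for the variable \<open>a\<close> is \<open>w \<partial>\<^sub>y - v \<partial>\<^sub>z\<close> or a cyclic shift of it; its
  derivative falls on \<open>q\<close>, and its factor \<open>u\<close>, \<open>v\<close> or \<open>w\<close> becomes a derivative of \<open>r\<close> by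
  adjointness.\<close>

lemma t_form_Var_mult_1:
  "t_form (Var a * p) q r =
    t_form p (pd (nxt a) q) (pd (nxt (nxt a)) r) - t_form p (pd (nxt (nxt a)) q) (pd (nxt a) r)"
  by (cases a) (simp_all add: t_form_def J_form_Var_mult polar_diff_left polar_Var_mult)

text \<open>Let \<open>p = x\<^sub>a p'\<close>. Expanding the left-hand side with the recursion in the first argument puts
  a derivative on \<open>x\<^sub>b q\<close>; expanding the right-hand side puts one on \<open>x\<^sub>a p'\<close>. The product rule
  contributes the same term \<open>\<Sum>\<^sub>k \<epsilon>\<^sub>a\<^sub>b\<^sub>k t(p', q, \<partial>\<^sub>k r)\<close> on both sides. In the remaining terms the
  variables \<open>x\<^sub>a\<close> and \<open>x\<^sub>b\<close> are both split off, in different orders, and the induction hypothesis for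
  \<open>p'\<close> identifies them because partial derivatives commute.\<close>

lemma t_form_Var_mult_2:
  "t_form p (Var b * q) r =
    t_form (pd (nxt (nxt b)) p) q (pd (nxt b) r) - t_form (pd (nxt b) p) q (pd (nxt (nxt b)) r)"
proof (induction p arbitrary: b q r rule: mpoly_induct)
  case (const c)
  show ?case by (simp add: t_form_Const const_coeff_Var_mult pd_Const t_form_zero)
next
  case (add p p')
  then show ?case by (simp add: t_form_add pd_add)
next
  case (Var_mult a p)
  show ?case
    by (cases a; cases b)
       (simp_all add: t_form_Var_mult_1 pd_Var_mult t_form_add t_form_zero Var_mult
         pd_commute[of Vy Vx] pd_commute[of Vz Vx] pd_commute[of Vz Vy])
qed

text \<open>Every variable split off from \<open>p\<close> contributes one sign, since the recursion is alternating in
  the last two arguments.\<close>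

lemma t_form_swap_23:
  assumes "p \<in> forms n"
  shows "t_form p r q = (-1) ^ n * t_form p q r"
  using assms
proof (induction arbitrary: q r rule: form_induct)
  case (Var_mult n a p)
  have "t_form p (pd i r) (pd j q) = (-1) ^ n * t_form p (pd j q) (pd i r)" for i j
    by (rule Var_mult)
  then show ?case by (simp add: t_form_Var_mult_1) (simp add: algebra_simps)
next
  case (add n p p')
  \<comment> \<open>The instance keeps the hypothesis from being rewritten back and forth.\<close>
  show ?case by (simp only: t_form_add add.IH[of r q] distrib_left)
qed (simp add: t_form_Const)

lemma t_form_Const_2: "t_form p (Const c) r = c * const_coeff p * const_coeff r"
proof (induction p arbitrary: r rule: mpoly_induct)
  case (const d)
  show ?case by (simp add: t_form_Const const_coeff_Const)
next
  case (add p q)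
  then show ?case by (simp add: t_form_add const_coeff_add distrib_left distrib_right)
next
  case (Var_mult v p)
  show ?case by (simp add: t_form_Var_mult_1 pd_Const t_form_zero const_coeff_Var_mult)
qed

text \<open>Here the sign comes from comparing the recursions in the first and in the second argument: they
  derive the other two arguments in opposite orders.\<close>

lemma t_form_swap_12:
  assumes "p \<in> forms n"
  shows "t_form q p r = (-1) ^ n * t_form p q r"
  using assms
proof (induction arbitrary: q r rule: form_induct)
  case (Var_mult n a p)
  have "t_form (pd i q) p (pd j r) = (-1) ^ n * t_form p (pd i q) (pd j r)" for i j
    by (rule Var_mult)
  then show ?case by (simp add: t_form_Var_mult_1 t_form_Var_mult_2) (simp add: algebra_simps)
qed (simp_all add: t_form_Const t_form_Const_2 t_form_add algebra_simps)

theorem theorem1p1: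
  fixes n :: nat and \<sigma> :: "nat \<Rightarrow> nat" and q :: "nat \<Rightarrow> (xyz, int) mpoly"
  assumes "\<sigma> permutes {1, 2, 3}"
    and "q 1 \<in> forms n" and "q 2 \<in> forms n" and "q 3 \<in> forms n"
  shows "t_form (q (\<sigma> 1)) (q (\<sigma> 2)) (q (\<sigma> 3)) = sign \<sigma> ^ n * t_form (q 1) (q 2) (q 3)"
proof -
  let ?I = "{1, 2, 3::nat}" and ?t = "\<lambda>f. t_form (f (1::nat)) (f 2) (f 3)"
  have q: "q i \<in> forms n" if "i \<in> ?I" for i using that assms(2-4) by auto
  have transpose: "?t (f \<circ> Transposition.transpose a b) = (-1) ^ n * ?t f"
    if f: "\<And>i. i \<in> ?I \<Longrightarrow> f i \<in> forms n" and ab: "a \<in> ?I" "b \<in> ?I" "a \<noteq> b" for f a b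
  proof -
    have swap: "t_form (f j) (f i) r = (-1) ^ n * t_form (f i) (f j) r"
        "t_form (f i) r s = (-1) ^ n * t_form (f i) s r" if "i \<in> ?I" for i j r s
      by (rule t_form_swap_12[OF f[OF that]] t_form_swap_23[OF f[OF that]])+
    \<comment> \<open>The transposition of 1 and 3 is a product of three adjacent ones, and \<open>(-1)\<^sup>3\<^sup>n = (-1)\<^sup>n\<close>.\<close>
    have "t_form (f 3) (f 2) (f 1) = (-1) ^ n * t_form (f 2) (f 3) (f 1)"
      by (rule swap) simp
    also have "t_form (f 2) (f 3) (f 1) = (-1) ^ n * t_form (f 2) (f 1) (f 3)"
      by (rule swap) simp
    also have "t_form (f 2) (f 1) (f 3) = (-1) ^ n * t_form (f 1) (f 2) (f 3)"
      by (rule swap) simp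
    finally have "t_form (f 3) (f 2) (f 1) = (-1) ^ n * t_form (f 1) (f 2) (f 3)"
      by (simp add: minus_one_power_iff)
    then show ?thesis
      using ab swap(1)[of 1 2 "f 3"] swap(2)[of 1 "f 3" "f 2"]
      by (auto simp: transpose_def)
  qed
  have "finite ?I" by simp
  then show ?thesis
    using assms(1)
  proof (induction rule: permutes_rev_induct)
    case (swap a b p)
    have "?t ((q \<circ> p) \<circ> Transposition.transpose a b) = (-1) ^ n * ?t (q \<circ> p)"
      using swap q by (intro transpose) (auto simp only: o_apply permutes_in_image)
    moreover have "sign (p \<circ> Transposition.transpose a b) = - sign p"
      using swap by (subst sign_compose)
        (auto simp: sign_swap_id permutation_swap_id intro: permutes_imp_permutation[of ?I])
    ultimately show ?case
      using swap.IH power_minus[of "sign p" n] by (simp add: o_def)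
  qed simp
qed

end
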